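(* Let $m\ge 1$, let $y_1,\ldots,y_m\in\mathbb{R}$ (support nodes) and $x_1,\ldots,x_{m-1}\in\mathbb{R}$ (test nodes) be given, all $2m-1$ nodes being pairwise distinct. Let $L\in\mathbb{C}^{(m-1)\times m}$ be the Loewner matrix with entries $$L_{kj}=\frac{\mathrm{e}^{\mathrm{i}x_k}-\mathrm{e}^{\mathrm{i}y_j}}{x_k-y_j},$$ and let $w=(w_1,\ldots,w_m)^\top\in\mathbb{C}^m$ satisfy $Lw=0$. Assume $w_j\neq 0$ for $j=1,\ldots,m$, and assume that the barycentric rational function $$r(x)=\sum_{j=1}^m\frac{\mathrm{e}^{\mathrm{i}y_j}w_j}{x-y_j}\Big/\sum_{j=1}^m\frac{w_j}{x-y_j}$$ is irreducible. Then $r$ interpolates $\mathrm{e}^{\mathrm{i}x}$ at the support and test nodes, i.e. $r(y_j)=\mathrm{e}^{\mathrm{i}y_j}$ for $j=1,\ldots,m$ and $r(x_k)=\mathrm{e}^{\mathrm{i}x_k}$ for $k=1,\ldots,m-1$; moreover $r$ has no poles on the real axis, and $|r(x)|=1$ for all $x\in\mathbb{R}$.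
   Context: With $\ell(x)=\prod_{j=1}^m(x-y_j)$, the barycentric rational function $r$ is identified with the rational function $r=p/q$, where $$p(x)=\sum_{j=1}^m \mathrm{e}^{\mathrm{i}y_j}w_j\prod_{k\ne j}(x-y_k),\qquad q(x)=\sum_{j=1}^m w_j\prod_{k\neq j}(x-y_k)$$ are polynomials of degree $\le m-1$ (obtained by multiplying numerator and denominator by $\ell$); in particular the singularities at the support nodes are removable and values $r(y_j)$ are understood as limits, i.e. via $p/q$. The function $r$ is called irreducible if $p$ and $q$ have no common (complex) zeros, and the poles of $r$ are the zeros of $q$. *)

theory Defs
  imports Complex_Main "HOL-Computational_Algebra.Polynomial" "Jordan_Normal_Form.Matrix"
begin

text \<open>
  Indices start at 0: the support nodes are \<open>y 0, \<dots>, y (m - 1)\<close>, the test nodes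
  \<open>x 0, \<dots>, x (m - 2)\<close>. Values of \<open>x\<close> and \<open>y\<close> outside these ranges are never used.
\<close>

definition loewner :: "nat \<Rightarrow> (nat \<Rightarrow> real) \<Rightarrow> (nat \<Rightarrow> real) \<Rightarrow> complex mat" where
  "loewner m x y = mat (m - 1) m (\<lambda>(k, j).
     (exp (\<i> * of_real (x k)) - exp (\<i> * of_real (y j))) / of_real (x k - y j))"

definition bary_num :: "nat \<Rightarrow> (nat \<Rightarrow> real) \<Rightarrow> complex vec \<Rightarrow> complex poly" where
  "bary_num m y w = (\<Sum>j<m. Polynomial.smult (exp (\<i> * of_real (y j)) * w $ j)
     (\<Prod>k\<in>{..<m} - {j}. [:- of_real (y k), 1:]))"

definition bary_den :: "nat \<Rightarrow> (nat \<Rightarrow> real) \<Rightarrow> complex vec \<Rightarrow> complex poly" where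
  "bary_den m y w = (\<Sum>j<m. Polynomial.smult (w $ j) (\<Prod>k\<in>{..<m} - {j}. [:- of_real (y k), 1:]))"

text \<open>
  The barycentric rational function with its removable singularities at the support nodes
  removed. It is only meaningful where the denominator does not vanish; at a zero of the
  denominator the quotient is 0 by the convention for division.
\<close>

definition bary_rat :: "nat \<Rightarrow> (nat \<Rightarrow> real) \<Rightarrow> complex vec \<Rightarrow> complex \<Rightarrow> complex" where
  "bary_rat m y w z = poly (bary_num m y w) z / poly (bary_den m y w) z"

definition bary_irreducible :: "nat \<Rightarrow> (nat \<Rightarrow> real) \<Rightarrow> complex vec \<Rightarrow> bool" where
  "bary_irreducible m y w \<longleftrightarrow>
     \<not> (\<exists>z. poly (bary_num m y w) z = 0 \<and> poly (bary_den m y w) z = 0)"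

definition bary_poles :: "nat \<Rightarrow> (nat \<Rightarrow> real) \<Rightarrow> complex vec \<Rightarrow> complex set" where
  "bary_poles m y w = {z. poly (bary_den m y w) z = 0}"

text \<open>
  Agreement with the barycentric formula: equality away from the support nodes, and
  equality of limits everywhere outside the poles.
\<close>

lemma nodal_sum:
  fixes y :: "nat \<Rightarrow> real" and c :: "nat \<Rightarrow> complex"
  assumes "\<And>j. j < m \<Longrightarrow> z \<noteq> of_real (y j)"
  shows "poly (\<Sum>j<m. Polynomial.smult (c j) (\<Prod>k\<in>{..<m} - {j}. [:- of_real (y k), 1:])) z
    = (\<Prod>k<m. z - of_real (y k)) * (\<Sum>j<m. c j / (z - of_real (y j)))"
proof -
  have "(\<Prod>k<m. z - of_real (y k)) * (c j / (z - of_real (y j)))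
      = c j * (\<Prod>k\<in>{..<m} - {j}. z - of_real (y k))" if "j < m" for j
    using that assms[OF that] by (simp add: prod.remove[of "{..<m}" j])
  then show ?thesis
    by (simp add: poly_sum poly_prod sum_distrib_left)
qed

lemma bary_rat_eq:
  assumes "\<And>j. j < m \<Longrightarrow> z \<noteq> of_real (y j)"
  shows "bary_rat m y w z =
    (\<Sum>j<m. exp (\<i> * of_real (y j)) * w $ j / (z - of_real (y j))) /
    (\<Sum>j<m. w $ j / (z - of_real (y j)))"
proof -
  have "(\<Prod>k<m. z - of_real (y k)) \<noteq> 0"
    using assms by auto
  moreover have "poly (bary_num m y w) z = (\<Prod>k<m. z - of_real (y k)) *
      (\<Sum>j<m. exp (\<i> * of_real (y j)) * w $ j / (z - of_real (y j)))"
    unfolding bary_num_def by (rule nodal_sum) (rule assms)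
  moreover have "poly (bary_den m y w) z = (\<Prod>k<m. z - of_real (y k)) *
      (\<Sum>j<m. w $ j / (z - of_real (y j)))"
    unfolding bary_den_def by (rule nodal_sum) (rule assms)
  ultimately show ?thesis
    unfolding bary_rat_def by simp
qed

lemma bary_rat_limit:
  assumes "z \<notin> bary_poles m y w"
  shows "((\<lambda>u. (\<Sum>j<m. exp (\<i> * of_real (y j)) * w $ j / (u - of_real (y j))) /
    (\<Sum>j<m. w $ j / (u - of_real (y j)))) \<longlongrightarrow> bary_rat m y w z) (at z)"
proof -
  have "(bary_rat m y w \<longlongrightarrow> bary_rat m y w z) (at z)"
    using assms unfolding bary_rat_def bary_poles_def
    by (intro tendsto_divide) (auto intro: isContD poly_isCont)
  moreover have "\<forall>\<^sub>F u in at z. \<forall>j\<in>{..<m}. u \<noteq> of_real (y j)"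
    by (intro eventually_ball_finite) (auto intro: eventually_neq_at_within)
  then have "\<forall>\<^sub>F u in at z. bary_rat m y w u =
      (\<Sum>j<m. exp (\<i> * of_real (y j)) * w $ j / (u - of_real (y j))) /
      (\<Sum>j<m. w $ j / (u - of_real (y j)))"
    by (rule eventually_mono) (auto intro!: bary_rat_eq)
  ultimately show ?thesis
    by (rule Lim_transform_eventually)
qed

end

theory Submission
  imports Defs
begin

text \<open>
  The condition \<open>L w = 0\<close> says exactly that \<open>p = exp (\<i> x\<^sub>k) q\<close> at each test node, and the same
  relation holds at the support nodes by construction. Hence \<open>\<bar>p\<bar>\<^sup>2 - \<bar>q\<bar>\<^sup>2\<close>, which on the real
  axis is a polynomial of degree at most \<open>2 m - 2\<close>, vanishes at all \<open>2 m - 1\<close> nodes, so it is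
  zero. A real zero of \<open>q\<close> would therefore be one of \<open>p\<close>, contradicting irreducibility.
\<close>

text \<open>The common shape of \<open>p\<close> and \<open>q\<close>, with free coefficients
  \<open>c\<close>, so that the degree bound and the values at the nodes are proved once for
  both.\<close>

definition nodal_poly :: "nat \<Rightarrow> (nat \<Rightarrow> real) \<Rightarrow> (nat \<Rightarrow> complex) \<Rightarrow> complex poly" where
  "nodal_poly m y c =
     (\<Sum>j<m. Polynomial.smult (c j) (\<Prod>k\<in>{..<m} - {j}. [:- of_real (y k), 1:]))"

lemma bary_num_eq_nodal_poly:
  "bary_num m y w = nodal_poly m y (\<lambda>j. exp (\<i> * of_real (y j)) * w $ j)"
  by (simp add: bary_num_def nodal_poly_def)

lemma bary_den_eq_nodal_poly: "bary_den m y w = nodal_poly m y (($) w)"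
  by (simp add: bary_den_def nodal_poly_def)

lemma degree_nodal_poly_le: "degree (nodal_poly m y c) \<le> m - 1"
proof -
  have "degree (\<Prod>k\<in>{..<m} - {j}. [:- of_real (y k), 1::complex:]) \<le> m - 1"
    if "j < m" for j
    using degree_prod_sum_le[of "{..<m} - {j}" "\<lambda>k. [:- of_real (y k), 1::complex:]"] that
    by simp
  then show ?thesis
    unfolding nodal_poly_def
    by (intro degree_sum_le) (auto intro: order_trans[OF degree_smult_le])
qed

text \<open>For \<open>j\<close> other than \<open>i\<close> the product omits only
  \<open>k = j\<close>, so it contains the zero factor \<open>k = i\<close>.\<close>

lemma poly_nodal_poly_node:
  assumes "i < m"
  shows "poly (nodal_poly m y c) (of_real (y i))
    = c i * (\<Prod>k\<in>{..<m} - {i}. of_real (y i) - of_real (y k))"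
proof -
  have "c j * (\<Prod>k\<in>{..<m} - {j}. of_real (y i) - of_real (y k))
      = (if j = i then c i * (\<Prod>k\<in>{..<m} - {i}. of_real (y i) - of_real (y k)) else 0)" for j
    using assms by auto
  then have "poly (nodal_poly m y c) (of_real (y i))
      = (\<Sum>j<m. if j = i then c i * (\<Prod>k\<in>{..<m} - {i}. of_real (y i) - of_real (y k)) else 0)"
    by (simp add: nodal_poly_def poly_sum poly_prod)
  with assms show ?thesis by simp
qed

text \<open>Kept free of division, since \<open>q\<close> is not yet known to be nonzero at the
  node.\<close>

lemma bary_num_support_node:
  assumes "j < m"
  shows "poly (bary_num m y w) (of_real (y j))
    = exp (\<i> * of_real (y j)) * poly (bary_den m y w) (of_real (y j))"
  using assms
  by (simp add: bary_num_eq_nodal_poly bary_den_eq_nodal_poly poly_nodal_poly_node)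

text \<open>Row \<open>k\<close> of the Loewner system splits into two partial fraction sums;
  multiplied by the product of all \<open>x k - y j\<close>, they become the values of
  \<open>q\<close> and \<open>p\<close> at \<open>x k\<close>.\<close>

lemma bary_num_test_node:
  assumes "k < m - 1" "x k \<notin> y ` {..<m}" "w \<in> carrier_vec m"
    and "loewner m x y *\<^sub>v w = 0\<^sub>v (m - 1)"
  shows "poly (bary_num m y w) (of_real (x k))
    = exp (\<i> * of_real (x k)) * poly (bary_den m y w) (of_real (x k))"
proof -
  let ?E = "\<lambda>t. exp (\<i> * of_real t) :: complex"
  let ?z = "of_real (x k) :: complex"
  have z: "?z \<noteq> of_real (y j)" if "j < m" for j
    using assms(2) that by auto
  have "0 = (loewner m x y *\<^sub>v w) $ k"
    using assms by simp
  also have "\<dots> = (\<Sum>j<m. (?E (x k) - ?E (y j)) / of_real (x k - y j) * w $ j)"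
    using assms(1,3) by (simp add: loewner_def scalar_prod_def atLeast0LessThan)
  also have "\<dots> = ?E (x k) * (\<Sum>j<m. w $ j / (?z - of_real (y j)))
      - (\<Sum>j<m. ?E (y j) * w $ j / (?z - of_real (y j)))"
    unfolding sum_distrib_left sum_subtractf[symmetric]
    by (intro sum.cong) (simp_all add: diff_divide_distrib ring_distribs)
  finally have "(\<Sum>j<m. ?E (y j) * w $ j / (?z - of_real (y j)))
      = ?E (x k) * (\<Sum>j<m. w $ j / (?z - of_real (y j)))"
    by simp
  then show ?thesis
    unfolding bary_num_def bary_den_def by (simp only: nodal_sum[OF z] mult.left_commute)
qed

lemma cmod_poly_eq_on_reals:
  fixes p q :: "complex poly"
  assumes "degree p < m" "degree q < m" "finite A" "2 * m - 1 \<le> card A"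
    and "\<And>t. t \<in> A \<Longrightarrow> cmod (poly p (of_real t)) = cmod (poly q (of_real t))"
  shows "cmod (poly p (of_real t)) = cmod (poly q (of_real t))"
proof -
  \<comment> \<open>Conjugating the coefficients conjugates the value at a real point, so
    \<open>N p\<close> is a polynomial that equals the squared modulus of \<open>p\<close> on the
    real axis.\<close>
  define N where "N p = p * map_poly cnj p" for p :: "complex poly"
  have N: "poly (N p) (of_real s) = of_real ((cmod (poly p (of_real s)))\<^sup>2)" for p s
    by (simp add: N_def complex_norm_square del: of_real_power)
  have deg: "degree (N p) < card (of_real ` A :: complex set)" if "degree p < m" for p
  proof -
    \<comment> \<open>Two factors of degree at most \<open>m - 1\<close> give at most
      \<open>2 * m - 2\<close>, one less than the number of points guaranteed in
      \<open>A\<close>.\<close>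
    have "degree (N p) \<le> degree p + degree p"
      using degree_mult_le[of p "map_poly cnj p"] by (simp add: N_def degree_map_poly)
    moreover have "card (of_real ` A :: complex set) = card A"
      by (intro card_image inj_onI) simp
    ultimately show ?thesis using that assms(4) by linarith
  qed
  have "N p = N q"
  proof (rule poly_eqI_degree[OF _ deg[OF assms(1)] deg[OF assms(2)]])
    fix z :: complex
    assume "z \<in> of_real ` A"
    then show "poly (N p) z = poly (N q) z"
      by (auto simp only: N assms(5))
  qed
  then have "complex_of_real ((cmod (poly p (of_real t)))\<^sup>2) = of_real ((cmod (poly q (of_real t)))\<^sup>2)"
    by (simp only: N[symmetric])
  then have "(cmod (poly p (of_real t)))\<^sup>2 = (cmod (poly q (of_real t)))\<^sup>2"
    by (simp only: of_real_eq_iff)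
  then show ?thesis by simp
qed

theorem corollary2:
  fixes m :: nat and x y :: "nat \<Rightarrow> real" and w :: "complex vec"
  assumes "m \<ge> 1"
    and "inj_on y {..<m}"
    and "inj_on x {..<m - 1}"
    and "x ` {..<m - 1} \<inter> y ` {..<m} = {}"
    and "w \<in> carrier_vec m"
    and "loewner m x y *\<^sub>v w = 0\<^sub>v (m - 1)"
    and "\<forall>j<m. w $ j \<noteq> 0"
    and "bary_irreducible m y w"
  shows "(\<forall>j<m. bary_rat m y w (of_real (y j)) = exp (\<i> * of_real (y j))) \<and>
    (\<forall>k<m - 1. bary_rat m y w (of_real (x k)) = exp (\<i> * of_real (x k))) \<and>
    (\<forall>t::real. of_real t \<notin> bary_poles m y w) \<and>
    (\<forall>t::real. cmod (bary_rat m y w (of_real t)) = 1)"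
proof -
  let ?p = "bary_num m y w" and ?q = "bary_den m y w"
  let ?A = "x ` {..<m - 1} \<union> y ` {..<m}"
  have test: "poly ?p (of_real (x k)) = exp (\<i> * of_real (x k)) * poly ?q (of_real (x k))"
    if "k < m - 1" for k
    using that assms(4-6) by (intro bary_num_test_node) auto
  have deg: "degree ?p < m" "degree ?q < m"
    using assms(1) degree_nodal_poly_le[THEN order_le_less_trans, of m m]
    by (simp_all add: bary_num_eq_nodal_poly bary_den_eq_nodal_poly)
  have "card ?A = 2 * m - 1"
    using assms(1-4) by (simp add: card_Un_disjoint card_image)
  \<comment> \<open>The interpolation factors \<open>exp (\<i> * of_real t)\<close> have modulus
    1.\<close>
  moreover have "cmod (poly ?p (of_real t)) = cmod (poly ?q (of_real t))" if "t \<in> ?A" for t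
    using that by (auto simp: test bary_num_support_node norm_mult)
  ultimately have cmod_eq: "cmod (poly ?p (of_real t)) = cmod (poly ?q (of_real t))" for t
    using cmod_poly_eq_on_reals[OF deg, of ?A] by simp
  have nz: "poly ?q (of_real t) \<noteq> 0" for t :: real
  proof
    assume "poly ?q (of_real t) = 0"
    moreover from this cmod_eq[of t] have "poly ?p (of_real t) = 0"
      by simp
    ultimately show False
      using assms(8) unfolding bary_irreducible_def by blast
  qed
  \<comment> \<open>With \<open>q\<close> nonzero on the real axis, the relations between
    \<open>p\<close> and \<open>q\<close> can be divided by \<open>q\<close> to give the values of
    \<open>bary_rat\<close> and their moduli.\<close>
  then show ?thesis
    by (simp add: bary_rat_def bary_poles_def bary_num_support_node test norm_divide cmod_eq)
qed

end
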